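(* Consider the nonlinear system $\dot x=AZ(x)+Bu+Ed(x)$ with $x\in\mathbb R^n$, $u\in\mathbb R^m$, $E=I_n$, $d:\mathbb R^n\to\mathbb R^n$ continuously differentiable (an unknown remainder), $A\in\mathbb R^{n\times s}$, $B\in\mathbb R^{n\times m}$, and $Z(x)=\begin{bmatrix} x \\ Q(x) \end{bmatrix}$, with $Z:\mathbb R^n\to\mathbb R^s$ continuously differentiable and $Q:\mathbb R^n\to\mathbb R^{s-n}$ containing only nonlinear functions. Let $U_0,X_1,Z_0$ and $D_0=[d(x(t_0))\ \cdots\ d(x(t_{T-1}))]\in\mathbb R^{n\times T}$ be the data matrices described in the context. Let $\mathcal X\subseteq\mathbb R^n$ be a set and $R_Q\in\mathbb R^{n\times\tau}$, $R_D\in\mathbb R^{n\times\tau_d}$ be matrices such that $$\frac{\partial Q}{\partial x}(x)^\top\frac{\partial Q}{\partial x}(x)\preceq R_QR_Q^\top,\qquad \frac{\partial d}{\partial x}(x)^\top\frac{\partial d}{\partial x}(x)\preceq R_DR_D^\top\qquad\text{for all }x\in\mathcal X.$$ Assume that, for a given matrix $\Delta$ with $n$ rows, $D_0\in\mathcal D:=\{D\in\mathbb R^{n\times T}:DD^\top\preceq\Delta\Delta^\top\}$. Consider the following semidefinite program in the decision variables $P\in\mathbb S^{n\times n}$, $Y_1\in\mathbb R^{T\times n}$, $G_2\in\mathbb R^{T\times(s-n)}$, $\alpha\in\mathbb R_{>0}$, $\mu\in\mathbb R_{>0}$: $$P\succ0,\qquad Z_0Y_1=\begin{bmatrix} P \\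 0_{(s-n)\times n} \end{bmatrix},\qquad Z_0G_2=\begin{bmatrix} 0_{n\times(s-n)} \\ I_{s-n} \end{bmatrix},$$ $$\begin{bmatrix} M(Y_1,\alpha,\mu) & \star & \star & \star \\ \begin{bmatrix} G_2^\top X_1^\top \\ I_n \end{bmatrix} & -I_s & \star & \star \\ \begin{bmatrix} R_Q^\top \\ R_D^\top \end{bmatrix}P & 0_{(\tau+\tau_d)\times s} & -I_{\tau+\tau_d} & \star \\ Y_1 & \begin{bmatrix} G_2 & 0_{T\times n} \end{bmatrix} & 0_{T\times(\tau+\tau_d)} & -\mu I_T \end{bmatrix}\preceq0,$$ where $M(Y_1,\alpha,\mu):=X_1Y_1+(X_1Y_1)^\top+\alpha I_n+\mu\Delta\Delta^\top$. If the program is feasible, then the control law $u=KZ(x)$ with $K=U_0\begin{bmatrix} Y_1P^{-1} & G_2 \end{bmatrix}$ is such that the closed-loop dynamics $\dot x=(A+BK)Z(x)+Ed(x)$ are exponentially contractive on $\mathcal X$, i.e., there exist $P\in\mathbb S^{n\times n}$, $P\succ0$, and $\beta>0$ such that for all $x\in\mathcal X$ $$\mathrm{Sym}\left[\Big((A+BK)\frac{\partial Z(x)}{\partial x}+E\frac{\partial d(x)}{\partial x}\Big)^\top P^{-1}\right]\preceq-\beta P^{-1}.$$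
   Context: $\mathbb S^{n\times n}$ is the set of real symmetric $n\times n$ matrices; $\succ,\succeq,\prec,\preceq$ refer to (semi)definiteness; $\mathrm{Sym}(M):=M+M^\top$; $\star$ denotes entries determined by symmetry of the block matrix. The matrices $A,B$ and the function $d$ are unknown to the designer, while $Z$ is known. Data: for an integer $T>0$ and distinct sampling times $t_0<\dots<t_{T-1}$, samples $x_i=x(t_i)$, $u_i=u(t_i)$, $\dot x_i=\dot x(t_i)$ satisfying $\dot x_i=AZ(x_i)+Bu_i+d(x_i)$, $i=0,\dots,T-1$, are collected in $$U_0=[u_0\ \cdots\ u_{T-1}]\in\mathbb R^{m\times T},\quad X_1=[\dot x_0\ \cdots\ \dot x_{T-1}]\in\mathbb R^{n\times T},\quad Z_0=[Z(x_0)\ \cdots\ Z(x_{T-1})]\in\mathbb R^{s\times T},$$ so that $X_1=AZ_0+BU_0+D_0$. *)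

theory Defs
  imports "HOL-Analysis.Analysis"
begin

definition continuously_differentiable :: "(real^'n \<Rightarrow> real^'m) \<Rightarrow> bool" where
  "continuously_differentiable f \<longleftrightarrow>
     (\<forall>x. f differentiable (at x)) \<and> continuous_on UNIV (\<lambda>x. jacobian f (at x))"

definition pos_semidef :: "real^'n^'n \<Rightarrow> bool" where
  "pos_semidef M \<longleftrightarrow> transpose M = M \<and> (\<forall>x. 0 \<le> x \<bullet> (M *v x))"

definition pos_def :: "real^'n^'n \<Rightarrow> bool" where
  "pos_def M \<longleftrightarrow> transpose M = M \<and> (\<forall>x. x \<noteq> 0 \<longrightarrow> 0 < x \<bullet> (M *v x))"

definition loewner_le :: "real^'n^'n \<Rightarrow> real^'n^'n \<Rightarrow> bool" (infix "\<preceq>" 50) where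
  "M \<preceq> N \<longleftrightarrow> pos_semidef (N - M)"

definition Sym :: "real^'n^'n \<Rightarrow> real^'n^'n" where
  "Sym M = M + transpose M"

(* Block vectors and matrices are indexed by sum types: Inl is the first block, Inr the second. *)

definition stack_vec :: "real^'a \<Rightarrow> real^'b \<Rightarrow> real^('a + 'b)" where
  "stack_vec v w = (\<chi> i. case i of Inl a \<Rightarrow> v $ a | Inr b \<Rightarrow> w $ b)"

definition vcat :: "real^'c^'a \<Rightarrow> real^'c^'b \<Rightarrow> real^'c^('a + 'b)" where
  "vcat M N = (\<chi> i. case i of Inl a \<Rightarrow> M $ a | Inr b \<Rightarrow> N $ b)"

definition hcat :: "real^'a^'r \<Rightarrow> real^'b^'r \<Rightarrow> real^('a + 'b)^'r" where
  "hcat M N = (\<chi> i. stack_vec (M $ i) (N $ i))"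

(* The symmetric 4x4 block matrix with the given lower triangle, listed row by row. *)
definition sym_block4 ::
  "real^'a^'a
   \<Rightarrow> real^'a^'b \<Rightarrow> real^'b^'b
   \<Rightarrow> real^'a^'c \<Rightarrow> real^'b^'c \<Rightarrow> real^'c^'c
   \<Rightarrow> real^'a^'d \<Rightarrow> real^'b^'d \<Rightarrow> real^'c^'d \<Rightarrow> real^'d^'d
   \<Rightarrow> real^('a + ('b + ('c + 'd)))^('a + ('b + ('c + 'd)))" where
  "sym_block4 M11 M21 M22 M31 M32 M33 M41 M42 M43 M44 =
     vcat (hcat M11 (hcat (transpose M21) (hcat (transpose M31) (transpose M41))))
    (vcat (hcat M21 (hcat            M22  (hcat (transpose M32) (transpose M42))))
    (vcat (hcat M31 (hcat            M32  (hcat            M33  (transpose M43))))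
          (hcat M41 (hcat            M42  (hcat            M43             M44)))))"

definition of_columns :: "('t \<Rightarrow> real^'n) \<Rightarrow> real^'t^'n" where
  "of_columns v = (\<chi> i j. v j $ i)"

(* Z(x) = [x; Q(x)] takes values in R^s, indexed by 'n + 'q with CARD('q) = s - n.  The second diagonal
   block I_s below is indexed by 'q + 'n instead, following the rows of [G2^T X1^T; I_n]. *)

definition lmi_matrix ::
  "real^'t^'n \<Rightarrow> real^'p^'n \<Rightarrow> real^'e^'n \<Rightarrow> real^'k^'n
   \<Rightarrow> real^'n^'n \<Rightarrow> real^'n^'t \<Rightarrow> real^'q^'t \<Rightarrow> real \<Rightarrow> real
   \<Rightarrow> real^('n + (('q + 'n) + (('p + 'e) + 't)))^('n + (('q + 'n) + (('p + 'e) + 't)))" where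
  "lmi_matrix X1 RQ RD \<Delta> P Y1 G2 \<alpha> \<mu> =
     sym_block4
       (X1 ** Y1 + transpose (X1 ** Y1) + \<alpha> *\<^sub>R mat 1 + \<mu> *\<^sub>R (\<Delta> ** transpose \<Delta>))
       (vcat (transpose G2 ** transpose X1) (mat 1)) (- mat 1)
       (vcat (transpose RQ) (transpose RD) ** P) 0 (- mat 1)
       Y1 (hcat G2 0) 0 (- (\<mu> *\<^sub>R mat 1))"

definition sdp_feasible ::
  "real^'t^('n + 'q) \<Rightarrow> real^'t^'n \<Rightarrow> real^'p^'n \<Rightarrow> real^'e^'n \<Rightarrow> real^'k^'n
   \<Rightarrow> real^'n^'n \<Rightarrow> real^'n^'t \<Rightarrow> real^'q^'t \<Rightarrow> real \<Rightarrow> real \<Rightarrow> bool" where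
  "sdp_feasible Z0 X1 RQ RD \<Delta> P Y1 G2 \<alpha> \<mu> \<longleftrightarrow>
     \<alpha> > 0 \<and> \<mu> > 0 \<and> pos_def P \<and>
     Z0 ** Y1 = vcat P 0 \<and>
     Z0 ** G2 = vcat 0 (mat 1) \<and>
     lmi_matrix X1 RQ RD \<Delta> P Y1 G2 \<alpha> \<mu> \<preceq> 0"

end

theory Submission
  imports Defs
begin

text \<open>
  Put \<open>w = P v\<close>. The equality constraints say that \<open>hcat (Y1 ** matrix_inv P) G2\<close> is a right
  inverse of \<open>Z0\<close>, so the data equation turns \<open>A + B ** K\<close> into \<open>(X1 - D0)\<close> times it. With \<open>q\<close>
  and \<open>e\<close> the images of \<open>w\<close> under the Jacobians of \<open>Q\<close> and \<open>d\<close>, the Jacobian of the closed loop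
  maps \<open>w\<close> to \<open>(X1 - D0) (Y1 v + G2 q) + e\<close>. Evaluating the quadratic form of the LMI at
  \<open>(v, (q, e), (RQ\<^sup>T w, RD\<^sup>T w), - D0\<^sup>T v)\<close> and discarding the differences that are nonnegative by
  the bounds on the Jacobians and on \<open>D0\<close> leaves \<open>2 v \<bullet> (closed loop) w \<le> - \<alpha> |v|\<^sup>2\<close>.
\<close>

section \<open>Block vectors and quadratic forms of block matrices\<close>

lemma inner_stack_vec: "stack_vec v w \<bullet> stack_vec v' w' = v \<bullet> v' + w \<bullet> w'"
  unfolding inner_vec_def stack_vec_def
  by (subst UNIV_Plus_UNIV[symmetric], subst sum.Plus) auto

lemma hcat_mult_stack_vec: "hcat M N *v stack_vec v w = M *v v + N *v w"
  by (simp add: vec_eq_iff matrix_vector_mul_component hcat_def inner_stack_vec)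

lemma vcat_mult_vec: "vcat M N *v v = stack_vec (M *v v) (N *v v)"
  by (auto simp: vec_eq_iff matrix_vector_mul_component vcat_def stack_vec_def split: sum.splits)

lemma stack_vec_add: "stack_vec v w + stack_vec v' w' = stack_vec (v + v') (w + w')"
  by (auto simp: stack_vec_def vec_eq_iff split: sum.splits)

lemma uminus_matrix_mult_vec:
  fixes M :: "real^'a^'b"
  shows "(- M) *v v = - (M *v v)"
  by (simp add: vec_eq_iff matrix_vector_mult_def sum_negf)

text \<open>The adjoint identity, with the transposed product in the form \<open>w v* M\<close> into
  which simp turns \<open>transpose M *v w\<close>.\<close>

lemma inner_vector_matrix_mult:
  fixes M :: "real^'a^'b"
  shows "v \<bullet> (w v* M) = w \<bullet> (M *v v)"
  by (metis dot_lmul_matrix inner_commute)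

lemma inner_gram_mult_vec:
  fixes M :: "real^'a^'b"
  shows "v \<bullet> ((M ** transpose M) *v v) = (transpose M *v v) \<bullet> (transpose M *v v)"
  by (metis dot_lmul_matrix matrix_vector_mul_assoc transpose_matrix_vector)

lemma loewner_le_inner: "M \<preceq> N \<Longrightarrow> v \<bullet> (M *v v) \<le> v \<bullet> (N *v v)"
  by (auto simp: loewner_le_def pos_semidef_def matrix_vector_mult_diff_rdistrib inner_diff_right)

text \<open>Turns the matrix bounds on \<open>D0\<close> and on the Jacobians into comparisons of
  squared norms. For a Jacobian, \<open>M\<close> is its transpose.\<close>

lemma gram_loewner_le_inner:
  fixes M :: "real^'a^'n" and N :: "real^'b^'n"
  assumes "M ** transpose M \<preceq> N ** transpose N"
  shows "(transpose M *v v) \<bullet> (transpose M *v v) \<le> (transpose N *v v) \<bullet> (transpose N *v v)"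
  using loewner_le_inner[OF assms, of v] by (simp add: inner_gram_mult_vec)

text \<open>A block above the diagonal contributes the same scalar as its mirror image below, so the
  lower triangle suffices, with a factor 2 on the cross terms.\<close>

lemma inner_sym_block4:
  "stack_vec p (stack_vec q (stack_vec r s)) \<bullet>
    (sym_block4 M11 M21 M22 M31 M32 M33 M41 M42 M43 M44 *v stack_vec p (stack_vec q (stack_vec r s)))
   = p \<bullet> (M11 *v p) + q \<bullet> (M22 *v q) + r \<bullet> (M33 *v r) + s \<bullet> (M44 *v s)
     + 2 * (q \<bullet> (M21 *v p) + r \<bullet> (M31 *v p) + s \<bullet> (M41 *v p)
          + r \<bullet> (M32 *v q) + s \<bullet> (M42 *v q) + s \<bullet> (M43 *v r))"
  by (simp add: sym_block4_def vcat_mult_vec hcat_mult_stack_vec inner_stack_vec inner_add_right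
      inner_vector_matrix_mult)

section \<open>Positive definite matrices and symmetrized products\<close>

lemma pos_def_matrix_inv:
  assumes "pos_def P"
  shows "P ** matrix_inv P = mat 1" and "matrix_inv P ** P = mat 1"
    and "pos_def (matrix_inv P)"
proof -
  have inj: "P *v v = 0 \<Longrightarrow> v = 0" for v
    using assms unfolding pos_def_def by (metis inner_zero_right less_irrefl)
  then have "invertible P"
    by (metis invertible_left_inverse matrix_left_invertible_ker)
  then have "P ** matrix_inv P = mat 1 \<and> matrix_inv P ** P = mat 1"
    unfolding invertible_def matrix_inv_def by (rule someI_ex)
  then show r: "P ** matrix_inv P = mat 1" and l: "matrix_inv P ** P = mat 1"
    by simp_all
  have symP: "transpose P = P"
    using assms by (simp add: pos_def_def)
  \<comment> \<open>Inserting \<open>P ** matrix_inv P\<close> and using the symmetry of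
    \<open>P\<close> regroups the first two factors into the transpose of an identity.\<close>
  have "transpose (matrix_inv P) = transpose (matrix_inv P) ** (P ** matrix_inv P)"
    by (simp add: r)
  also have "\<dots> = transpose (P ** matrix_inv P) ** matrix_inv P"
    by (simp only: matrix_transpose_mul symP matrix_mul_assoc)
  also have "\<dots> = matrix_inv P"
    by (simp add: r)
  finally have symI: "transpose (matrix_inv P) = matrix_inv P" .
  have "0 < w \<bullet> (matrix_inv P *v w)" if "w \<noteq> 0" for w
  proof -
    have w: "w = P *v (matrix_inv P *v w)"
      by (simp add: matrix_vector_mul_assoc r)
    then have "matrix_inv P *v w \<noteq> 0"
      using that by auto
    then have "0 < (matrix_inv P *v w) \<bullet> (P *v (matrix_inv P *v w))"
      using assms by (simp add: pos_def_def)
    then show ?thesis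
      using w by (simp add: inner_commute)
  qed
  then show "pos_def (matrix_inv P)"
    using symI by (simp add: pos_def_def)
qed

text \<open>The LMI yields decay in terms of \<open>v \<bullet> v\<close>, whereas contraction is
  measured by \<open>v \<bullet> (P *v v)\<close>. Boundedness of \<open>P\<close> permits the
  exchange at the price of a smaller rate.\<close>

lemma pos_def_quadratic_form_bound:
  assumes "pos_def P" "\<alpha> > 0"
  obtains \<beta> where "\<beta> > 0" "\<And>v. \<beta> * (v \<bullet> (P *v v)) \<le> \<alpha> * (v \<bullet> v)"
proof
  \<comment> \<open>The summand 1 gives a positive divisor from mere nonnegativity of the operator
    norm.\<close>
  let ?c = "1 + onorm ((*v) P)"
  have c: "?c > 0"
    using onorm_pos_le[OF matrix_vector_mul_bounded_linear[of P]] by linarith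
  then show "\<alpha> / ?c > 0"
    using assms by simp
  show "\<alpha> / ?c * (v \<bullet> (P *v v)) \<le> \<alpha> * (v \<bullet> v)" for v
  proof -
    have "v \<bullet> (P *v v) \<le> norm v * norm (P *v v)"
      by (rule norm_cauchy_schwarz)
    also have "\<dots> \<le> norm v * (onorm ((*v) P) * norm v)"
      by (intro mult_left_mono onorm matrix_vector_mul_bounded_linear norm_ge_zero)
    also have "\<dots> \<le> ?c * (v \<bullet> v)"
      by (simp add: dot_square_norm power2_eq_square algebra_simps)
    finally have "\<alpha> * (v \<bullet> (P *v v)) \<le> \<alpha> * (?c * (v \<bullet> v))"
      using assms by (intro mult_left_mono) auto
    then show ?thesis
      using c by (simp add: field_simps)
  qed
qed

lemma inner_Sym_transpose_mult_vec:
  fixes M N :: "real^'n^'n"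
  assumes "transpose N = N"
  shows "w \<bullet> (Sym (transpose M ** N) *v w) = 2 * ((N *v w) \<bullet> (M *v w))"
  by (simp add: Sym_def matrix_vector_mult_add_rdistrib inner_add_right matrix_transpose_mul assms
      matrix_vector_mul_assoc[symmetric] inner_vector_matrix_mult)
    (metis assms dot_lmul_matrix inner_commute transpose_matrix_vector)

lemma transpose_Sym: "transpose (Sym M) = Sym M"
  by (simp add: Sym_def transpose_def vec_eq_iff add.commute)

section \<open>The Jacobian of \<open>Z\<close>\<close>

lemma bounded_linear_reindex: "bounded_linear (\<lambda>z::real^'a. (\<chi> i. z $ f i) :: real^'b)"
  by (simp add: linear_conv_bounded_linear[symmetric] linear_iff vec_eq_iff)

text \<open>Differentiability is given for \<open>Z\<close> only. Projecting its derivative onto the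
  two blocks yields derivatives of the identity and of \<open>Q\<close>, and uniqueness of
  derivatives identifies them.\<close>

lemma jacobian_stack_vec:
  fixes Q :: "real^'n \<Rightarrow> real^'q" and Z :: "real^'n \<Rightarrow> real^('n::finite + 'q::finite)"
  assumes Z: "\<And>z. Z z = stack_vec z (Q z)" and diff: "Z differentiable (at z)"
  shows "jacobian Z (at z) *v w = stack_vec w (jacobian Q (at z) *v w)"
proof -
  let ?J = "jacobian Z (at z)"
  have derZ: "(Z has_derivative (*v) ?J) (at z)"
    using diff by (simp add: jacobian_works)
  have "((\<lambda>y. y) has_derivative (\<lambda>w. \<chi> i. (?J *v w) $ Inl i)) (at z)"
    using bounded_linear.has_derivative[OF bounded_linear_reindex derZ, of Inl]
    by (simp add: Z stack_vec_def)
  from has_derivative_unique[OF this has_derivative_ident]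
  have fst: "(\<chi> i. (?J *v w) $ Inl i) = w"
    by (rule fun_cong)
  have derQ: "(Q has_derivative (\<lambda>w. \<chi> j. (?J *v w) $ Inr j)) (at z)"
    using bounded_linear.has_derivative[OF bounded_linear_reindex derZ, of Inr]
    by (simp add: Z stack_vec_def)
  then have "Q differentiable (at z)"
    by (auto simp: differentiable_def)
  then have "(Q has_derivative (*v) (jacobian Q (at z))) (at z)"
    by (simp add: jacobian_works)
  from has_derivative_unique[OF this derQ]
  have snd: "jacobian Q (at z) *v w = (\<chi> j. (?J *v w) $ Inr j)"
    by (rule fun_cong)
  \<comment> \<open>Only the \<open>w\<close> forming the first block is rewritten; both sides then
    have the same components.\<close>
  show ?thesis
    unfolding snd by (subst (2) fst[symmetric])
      (auto simp: vec_eq_iff stack_vec_def split: sum.splits)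
qed

section \<open>Data equation, LMI and closed loop\<close>

lemma matrix_mult_of_columns: "M ** of_columns f = of_columns (\<lambda>i. M *v f i)"
  by (simp add: vec_eq_iff of_columns_def matrix_matrix_mult_def matrix_vector_mult_def)

lemma of_columns_add: "of_columns f + of_columns g = of_columns (\<lambda>i. f i + g i)"
  by (simp add: vec_eq_iff of_columns_def)

lemma lmi_quadratic_form_bound:
  fixes X1 D0 :: "real^'t^'n" and RQ :: "real^'p^'n" and RD :: "real^'e^'n" and \<Delta> :: "real^'k^'n"
    and G2 :: "real^'q^'t" and q :: "real^'q"
  assumes lmi: "lmi_matrix X1 RQ RD \<Delta> P Y1 G2 \<alpha> \<mu> \<preceq> 0"
    and "\<mu> > 0"
    and D0: "D0 ** transpose D0 \<preceq> \<Delta> ** transpose \<Delta>"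
    and q: "q \<bullet> q \<le> (transpose RQ *v (P *v v)) \<bullet> (transpose RQ *v (P *v v))"
    and e: "e \<bullet> e \<le> (transpose RD *v (P *v v)) \<bullet> (transpose RD *v (P *v v))"
  shows "2 * (v \<bullet> ((X1 - D0) *v (Y1 *v v + G2 *v q) + e)) \<le> - \<alpha> * (v \<bullet> v)"
proof -
  define y where "y = transpose RQ *v (P *v v)"
  define y' where "y' = transpose RD *v (P *v v)"
  define s where "s = transpose D0 *v v"
  define h where "h = transpose \<Delta> *v v"
  \<comment> \<open>The third block has cross terms twice its squared norm and diagonal term minus
    that norm, so \<open>y \<bullet> y + y' \<bullet> y'\<close> remains to dominate
    \<open>q \<bullet> q + e \<bullet> e\<close>. The sign of \<open>- s\<close> makes the last row
    produce the unknown term \<open>- D0 *v (Y1 *v v + G2 *v q)\<close> paired with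
    \<open>v\<close>; its cost \<open>\<mu> * (s \<bullet> s)\<close> is covered by
    \<open>\<mu> * (h \<bullet> h)\<close>.\<close>
  let ?\<xi> = "stack_vec v (stack_vec (stack_vec q e) (stack_vec (stack_vec y y') (- s)))"
  have "?\<xi> \<bullet> (lmi_matrix X1 RQ RD \<Delta> P Y1 G2 \<alpha> \<mu> *v ?\<xi>) \<le> 0"
    using loewner_le_inner[OF lmi, of ?\<xi>] by simp
  moreover have "?\<xi> \<bullet> (lmi_matrix X1 RQ RD \<Delta> P Y1 G2 \<alpha> \<mu> *v ?\<xi>) =
      2 * (v \<bullet> (X1 *v (Y1 *v v))) + \<alpha> * (v \<bullet> v) + \<mu> * (h \<bullet> h)
      - q \<bullet> q - e \<bullet> e + y \<bullet> y + y' \<bullet> y' - \<mu> * (s \<bullet> s)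
      + 2 * (v \<bullet> (X1 *v (G2 *v q)) + v \<bullet> e - s \<bullet> (Y1 *v v) - s \<bullet> (G2 *v q))"
  proof -
    have "v \<bullet> ((\<Delta> ** transpose \<Delta>) *v v) = h \<bullet> h"
      by (simp add: inner_gram_mult_vec h_def)
    moreover have "v \<bullet> (transpose (X1 ** Y1) *v v) = v \<bullet> (X1 *v (Y1 *v v))"
      by (simp add: inner_vector_matrix_mult matrix_vector_mul_assoc)
    moreover have "q \<bullet> ((transpose G2 ** transpose X1) *v v) = v \<bullet> (X1 *v (G2 *v q))"
      by (simp add: matrix_transpose_mul[symmetric] inner_vector_matrix_mult matrix_vector_mul_assoc)
    moreover have "(vcat (transpose RQ) (transpose RD) ** P) *v v = stack_vec y y'"
      by (simp add: matrix_vector_mul_assoc[symmetric] vcat_mult_vec y_def y'_def)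
    ultimately show ?thesis
      unfolding lmi_matrix_def inner_sym_block4
      by (simp add: vcat_mult_vec hcat_mult_stack_vec inner_stack_vec inner_add_right
          uminus_matrix_mult_vec matrix_vector_mult_add_rdistrib scaleR_matrix_vector_assoc[symmetric]
          matrix_vector_mul_assoc[symmetric] inner_commute[of e v])
  qed
  moreover have "v \<bullet> (D0 *v r) = s \<bullet> r" for r
    by (simp add: s_def dot_lmul_matrix)
  then have "v \<bullet> ((X1 - D0) *v (Y1 *v v + G2 *v q) + e) =
      v \<bullet> (X1 *v (Y1 *v v)) + v \<bullet> (X1 *v (G2 *v q)) + v \<bullet> e - s \<bullet> (Y1 *v v) - s \<bullet> (G2 *v q)"
    by (simp add: inner_add_right inner_diff_right matrix_vector_mult_diff_rdistrib
        matrix_vector_right_distrib)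
  moreover have "\<mu> * (s \<bullet> s) \<le> \<mu> * (h \<bullet> h)"
    using gram_loewner_le_inner[OF D0, of v] \<open>\<mu> > 0\<close> by (simp add: s_def h_def)
  ultimately show ?thesis
    using q e unfolding y_def[symmetric] y'_def[symmetric] by argo
qed

text \<open>With \<open>r = Y1 *v v + G2 *v q\<close>, the matrix \<open>Z0\<close> maps
  \<open>r\<close> to the stacked vector and \<open>U0\<close> maps \<open>r\<close> to the image of
  that vector under \<open>K\<close>. Applying the data equation to \<open>r\<close> thus eliminates
  the unknown \<open>A\<close> and \<open>B\<close>.\<close>

lemma closed_loop_data_representation:
  fixes Z0 :: "real^'t^('n::finite + 'q::finite)" and P :: "real^'n^'n" and G2 :: "real^'q^'t"
  assumes X1: "X1 = A ** Z0 + B ** U0 + D0"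
    and Y1: "Z0 ** Y1 = vcat P 0" and G2: "Z0 ** G2 = vcat 0 (mat 1)"
    and inv: "matrix_inv P ** P = mat 1"
    and K: "K = U0 ** hcat (Y1 ** matrix_inv P) G2"
  shows "(A + B ** K) *v stack_vec (P *v v) q = (X1 - D0) *v (Y1 *v v + G2 *v q)"
proof -
  let ?r = "Y1 *v v + G2 *v q"
  have hcat: "hcat (Y1 ** matrix_inv P) G2 *v stack_vec (P *v v) q = ?r"
    by (simp add: hcat_mult_stack_vec matrix_vector_mul_assoc matrix_mul_assoc[symmetric] inv)
  have "Z0 *v ?r = stack_vec (P *v v) q"
    by (simp add: matrix_vector_right_distrib matrix_vector_mul_assoc Y1 G2 vcat_mult_vec
        stack_vec_add)
  then have "(X1 - D0) *v ?r = A *v stack_vec (P *v v) q + B *v (U0 *v ?r)"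
    by (simp add: X1 matrix_vector_mult_add_rdistrib matrix_vector_mul_assoc[symmetric])
  also have "\<dots> = (A + B ** K) *v stack_vec (P *v v) q"
    by (simp add: K matrix_vector_mult_add_rdistrib matrix_vector_mul_assoc[symmetric] hcat)
  finally show ?thesis ..
qed

theorem theorem4:
  fixes A :: "real^('n::finite + 'q::finite)^'n" and B :: "real^'m::finite^'n" and E :: "real^'n^'n"
    and Q :: "real^'n \<Rightarrow> real^'q" and Z :: "real^'n \<Rightarrow> real^('n + 'q)" and d :: "real^'n \<Rightarrow> real^'n"
    and a b :: real and t :: "'t::{finite,linorder} \<Rightarrow> real"
    and x xdot :: "real \<Rightarrow> real^'n" and u :: "real \<Rightarrow> real^'m"
    and U0 :: "real^'t::{finite,linorder}^'m" and X1 D0 :: "real^'t::{finite,linorder}^'n" and Z0 :: "real^'t::{finite,linorder}^('n + 'q)"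
    and \<X> :: "(real^'n) set"
    and RQ :: "real^'p::finite^'n" and RD :: "real^'e::finite^'n" and \<Delta> :: "real^'k::finite^'n"
    and P :: "real^'n^'n" and Y1 :: "real^'n^'t::{finite,linorder}" and G2 :: "real^'q^'t::{finite,linorder}" and \<alpha> \<mu> :: real
    and K :: "real^('n + 'q)^'m"
  assumes E: "E = mat 1"
    and Z: "\<And>z. Z z = stack_vec z (Q z)"
    and C1_Z: "continuously_differentiable Z"
    and nonlinear_Q: "\<And>j. \<not> linear (\<lambda>z. Q z $ j)"
    and C1_d: "continuously_differentiable d"
    and times: "a < b" "strict_mono t" "range t \<subseteq> {a..b}"
    and xdot: "\<And>i. (x has_vector_derivative xdot (t i)) (at (t i) within {a..b})"
    and samples: "\<And>i. xdot (t i) = A *v Z (x (t i)) + B *v u (t i) + E *v d (x (t i))"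
    and U0: "U0 = of_columns (\<lambda>i. u (t i))"
    and X1: "X1 = of_columns (\<lambda>i. xdot (t i))"
    and Z0: "Z0 = of_columns (\<lambda>i. Z (x (t i)))"
    and D0: "D0 = of_columns (\<lambda>i. d (x (t i)))"
    and RQ: "\<And>z. z \<in> \<X> \<Longrightarrow>
      transpose (jacobian Q (at z)) ** jacobian Q (at z) \<preceq> RQ ** transpose RQ"
    and RD: "\<And>z. z \<in> \<X> \<Longrightarrow>
      transpose (jacobian d (at z)) ** jacobian d (at z) \<preceq> RD ** transpose RD"
    and D0_bound: "D0 \<in> {D. D ** transpose D \<preceq> \<Delta> ** transpose \<Delta>}"
    and feasible: "sdp_feasible Z0 X1 RQ RD \<Delta> P Y1 G2 \<alpha> \<mu>"
    and K: "K = U0 ** hcat (Y1 ** matrix_inv P) G2"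
  shows "\<exists>P' \<beta>. pos_def P' \<and> \<beta> > 0 \<and>
    (\<forall>z\<in>\<X>.
      Sym (transpose ((A + B ** K) ** jacobian Z (at z) + E ** jacobian d (at z)) ** matrix_inv P')
        \<preceq> - \<beta> *\<^sub>R matrix_inv P')"
proof -
  from feasible have pos: "\<alpha> > 0" "\<mu> > 0" and P: "pos_def P"
    and Y1: "Z0 ** Y1 = vcat P 0" and G2: "Z0 ** G2 = vcat 0 (mat 1)"
    and lmi: "lmi_matrix X1 RQ RD \<Delta> P Y1 G2 \<alpha> \<mu> \<preceq> 0"
    by (auto simp: sdp_feasible_def)
  note inv = pos_def_matrix_inv[OF P]
  have symI: "transpose (matrix_inv P) = matrix_inv P"
    using inv(3) by (simp add: pos_def_def)
  have data: "X1 = A ** Z0 + B ** U0 + D0"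
    by (simp add: X1 Z0 U0 D0 samples E matrix_mult_of_columns of_columns_add)
  \<comment> \<open>The rate is fixed before any point \<open>z\<close> is chosen, hence it is
    uniform on \<open>\<X>\<close>.\<close>
  obtain \<beta> where \<beta>: "\<beta> > 0" "\<And>v. \<beta> * (v \<bullet> (P *v v)) \<le> \<alpha> * (v \<bullet> v)"
    using pos_def_quadratic_form_bound[OF P pos(1)] by blast
  have "Sym (transpose ((A + B ** K) ** jacobian Z (at z) + E ** jacobian d (at z)) ** matrix_inv P)
        \<preceq> - \<beta> *\<^sub>R matrix_inv P" (is "Sym (transpose ?J ** _) \<preceq> _") if z: "z \<in> \<X>" for z
    unfolding loewner_le_def pos_semidef_def
  proof (intro conjI allI)
    show "transpose (- \<beta> *\<^sub>R matrix_inv P - Sym (transpose ?J ** matrix_inv P)) =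
        - \<beta> *\<^sub>R matrix_inv P - Sym (transpose ?J ** matrix_inv P)"
      using symI transpose_Sym[of "transpose ?J ** matrix_inv P"]
      by (simp add: transpose_def vec_eq_iff)
    fix w :: "real^'n"
    \<comment> \<open>This substitution turns \<open>w \<bullet> (matrix_inv P *v w)\<close> into
      \<open>v \<bullet> (P *v v)\<close> and the symmetrized form into
      \<open>2 * (v \<bullet> (?J *v w))\<close>, the quantities that the LMI controls.\<close>
    define v where "v = matrix_inv P *v w"
    have w: "w = P *v v"
      by (simp add: v_def matrix_vector_mul_assoc inv)
    define q where "q = jacobian Q (at z) *v w"
    define e where "e = jacobian d (at z) *v w"
    have "q \<bullet> q \<le> (transpose RQ *v w) \<bullet> (transpose RQ *v w)"
      using gram_loewner_le_inner[of "transpose (jacobian Q (at z))" RQ w] RQ[OF z]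
      by (simp add: q_def)
    moreover have "e \<bullet> e \<le> (transpose RD *v w) \<bullet> (transpose RD *v w)"
      using gram_loewner_le_inner[of "transpose (jacobian d (at z))" RD w] RD[OF z]
      by (simp add: e_def)
    ultimately have "2 * (v \<bullet> ((X1 - D0) *v (Y1 *v v + G2 *v q) + e)) \<le> - \<alpha> * (v \<bullet> v)"
      using lmi_quadratic_form_bound[OF lmi pos(2)] D0_bound w by simp
    moreover have "?J *v w = (X1 - D0) *v (Y1 *v v + G2 *v q) + e"
    proof -
      have "Z differentiable (at z)"
        using C1_Z by (simp add: continuously_differentiable_def)
      then have "jacobian Z (at z) *v w = stack_vec (P *v v) q"
        using jacobian_stack_vec[OF Z] w by (simp add: q_def)
      then show ?thesis
        using closed_loop_data_representation[OF data Y1 G2 inv(2) K, of v q]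
        by (simp add: E e_def matrix_vector_mult_add_rdistrib matrix_vector_mul_assoc[symmetric])
    qed
    ultimately have "2 * (v \<bullet> (?J *v w)) \<le> - \<beta> * (v \<bullet> w)"
      using \<beta>(2)[of v] w by simp
    then show "0 \<le> w \<bullet> ((- \<beta> *\<^sub>R matrix_inv P - Sym (transpose ?J ** matrix_inv P)) *v w)"
      unfolding matrix_vector_mult_diff_rdistrib inner_diff_right
        inner_Sym_transpose_mult_vec[OF symI] scaleR_matrix_vector_assoc[symmetric] v_def[symmetric]
      by (simp add: inner_commute)
  qed
  with P \<beta>(1) show ?thesis
    by blast
qed

end
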